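(* Let $(\mathcal{E}^{in},\mathcal{E}^{out},\mathcal{H},U)$ be a finite-dimensional unitary colligation with block decomposition $U=\begin{bmatrix}A&B\\ C&D\end{bmatrix}$, and let $$S(z)=A+zB(I_{\mathcal{H}}-zD)^{-1}C$$ be its characteristic function. Then $S(z)$ is a rational inner function.
   Context: $\mathbb{D}=\{z\in\mathbb{C}:|z|<1\}$, $\mathbb{T}=\{t\in\mathbb{C}:|t|=1\}$. An operator colligation is a quadruple $(\mathcal{E}^{in},\mathcal{E}^{out},\mathcal{H},U)$ where $\mathcal{E}^{in},\mathcal{E}^{out},\mathcal{H}$ are (complex) Hilbert spaces and $U:\mathcal{E}^{in}\oplus\mathcal{H}\to\mathcal{E}^{out}\oplus\mathcal{H}$ is a bounded linear operator with blocks $A:\mathcal{E}^{in}\to\mathcal{E}^{out}$, $B:\mathcal{H}\to\mathcal{E}^{out}$, $C:\mathcal{E}^{in}\to\mathcal{H}$, $D:\mathcal{H}\to\mathcal{H}$. It is finite-dimensional if all three spaces are finite-dimensional, and unitary if $U^*U=I$ and $UU^*=I$. The characteristic function is defined at those $z$ for which $I_{\mathcal{H}}-zD$ is invertible, and is regarded as a rational function. A rational function $S$ whose values are operators from a finite-dimensional Hilbert space $\mathcal{E}_1$ to a finite-dimensional Hilbert space $\mathcal{E}_2$ is called inner if it has no singularities in $\mathbb{D}\cup\mathbb{T}$, $I-S^*(z)S(z)\ge 0$ and $I-S(z)S^*(z)\ge 0$ for $z\in\mathbb{D}$, and $I-S^*(t)S(t)=0$ and $I-S(t)S^*(t)=0$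 for $t\in\mathbb{T}$ (where $S^*(z)=S(z)^*$). *)

theory Defs
  imports "HOL-Analysis.Analysis" "HOL-Computational_Algebra.Polynomial"
begin

section \<open>Complex Hilbert spaces\<close>

text \<open>
  A complex inner product space carries the real inner product \<open>Re \<langle>x, y\<rangle>\<close>, and hence the norm
  \<open>sqrt \<langle>x, x\<rangle>\<close> and the topology of the library class \<open>real_inner\<close>. Positive definiteness
  of \<^term>\<open>cinner\<close> is inherited from \<open>real_inner\<close>. The inner product is linear in its
  first argument. No dimension is excluded; in particular the zero space is allowed.
\<close>

class complex_inner = real_inner +
  fixes scaleC :: "complex \<Rightarrow> 'a \<Rightarrow> 'a" (infixr \<open>*\<^sub>C\<close> 75)
    and cinner :: "'a \<Rightarrow> 'a \<Rightarrow> complex"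
  assumes scaleC_add_right: "c *\<^sub>C (x + y) = c *\<^sub>C x + c *\<^sub>C y"
    and scaleC_add_left: "(c + d) *\<^sub>C x = c *\<^sub>C x + d *\<^sub>C x"
    and scaleC_scaleC: "c *\<^sub>C (d *\<^sub>C x) = (c * d) *\<^sub>C x"
    and scaleR_eq_scaleC: "scaleR r x = complex_of_real r *\<^sub>C x"
    and cinner_commute: "cinner x y = cnj (cinner y x)"
    and cinner_add_left: "cinner (x + y) z = cinner x z + cinner y z"
    and cinner_scaleC_left: "cinner (c *\<^sub>C x) y = c * cinner x y"
    and inner_eq_Re_cinner: "inner x y = Re (cinner x y)"

class chilbert_space = complex_inner + complete_space

instantiation complex :: chilbert_space
begin
definition scaleC_complex_def: "c *\<^sub>C (x :: complex) = c * x"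
definition cinner_complex_def: "cinner (x :: complex) y = x * cnj y"
instance
  by standard
    (simp_all add: scaleC_complex_def cinner_complex_def algebra_simps scaleR_conv_of_real
      inner_complex_def)
end

instantiation prod :: (complex_inner, complex_inner) complex_inner
begin
definition scaleC_prod_def: "c *\<^sub>C (p :: 'a \<times> 'b) = (c *\<^sub>C fst p, c *\<^sub>C snd p)"
definition cinner_prod_def:
  "cinner (p :: 'a \<times> 'b) q = cinner (fst p) (fst q) + cinner (snd p) (snd q)"
instance
proof
  fix x y :: "'a \<times> 'b"
  show "cinner x y = cnj (cinner y x)"
    unfolding cinner_prod_def complex_cnj_add
    by (simp only: cinner_commute[symmetric])
qed (simp_all add: scaleC_prod_def cinner_prod_def inner_prod_def prod_eq_iff scaleC_add_right
      scaleC_add_left scaleC_scaleC scaleR_eq_scaleC cinner_add_left cinner_scaleC_left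
      inner_eq_Re_cinner algebra_simps)
end

instance prod :: (chilbert_space, chilbert_space) chilbert_space ..

lemma scaleC_one: "1 *\<^sub>C (x :: 'a :: complex_inner) = x"
  using scaleR_eq_scaleC[of 1 x] by simp

lemma vector_space_scaleC: "vector_space (scaleC :: complex \<Rightarrow> 'a :: complex_inner \<Rightarrow> 'a)"
  by standard (simp_all add: scaleC_add_right scaleC_add_left scaleC_scaleC scaleC_one)

definition finite_dimensional :: "'a :: complex_inner itself \<Rightarrow> bool" where
  "finite_dimensional _ \<longleftrightarrow>
     (\<exists>B :: 'a set. finite B \<and> module.span scaleC B = UNIV)"


section \<open>Operators\<close>

definition bounded_operator :: "('a :: complex_inner \<Rightarrow> 'b :: complex_inner) \<Rightarrow> bool" where
  "bounded_operator T \<longleftrightarrow> Vector_Spaces.linear scaleC scaleC T \<and> bounded_linear T"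

definition cadjoint :: "('a :: complex_inner \<Rightarrow> 'b :: complex_inner) \<Rightarrow> 'b \<Rightarrow> 'a" where
  "cadjoint T = (SOME T'. \<forall>x y. cinner (T x) y = cinner x (T' y))"

definition positive_operator :: "('a :: complex_inner \<Rightarrow> 'a) \<Rightarrow> bool" where
  "positive_operator T \<longleftrightarrow> (\<forall>x. cinner (T x) x \<in> \<real> \<and> 0 \<le> Re (cinner (T x) x))"

definition invertible_operator :: "('a :: complex_inner \<Rightarrow> 'a) \<Rightarrow> bool" where
  "invertible_operator T \<longleftrightarrow>
     (\<exists>R. bounded_operator R \<and> R \<circ> T = id \<and> T \<circ> R = id)"


section \<open>Colligations and their characteristic functions\<close>

text \<open>
  The spaces of a colligation are the types \<open>'e\<close> (input), \<open>'f\<close> (output) and \<open>'h\<close> (state)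
  occurring in the type of the operator; direct sums are product types.
\<close>

definition operator_colligation ::
    "('e :: chilbert_space \<times> 'h :: chilbert_space \<Rightarrow> 'f :: chilbert_space \<times> 'h) \<Rightarrow> bool" where
  "operator_colligation U \<longleftrightarrow> bounded_operator U"

definition finite_dimensional_colligation ::
    "('e :: chilbert_space \<times> 'h :: chilbert_space \<Rightarrow> 'f :: chilbert_space \<times> 'h) \<Rightarrow> bool" where
  "finite_dimensional_colligation U \<longleftrightarrow>
     finite_dimensional TYPE('e) \<and> finite_dimensional TYPE('f) \<and> finite_dimensional TYPE('h)"

definition unitary_colligation ::
    "('e :: chilbert_space \<times> 'h :: chilbert_space \<Rightarrow> 'f :: chilbert_space \<times> 'h) \<Rightarrow> bool" where
  "unitary_colligation U \<longleftrightarrow> cadjoint U \<circ> U = id \<and> U \<circ> cadjoint U = id"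

definition blockA :: "('e :: zero \<times> 'h :: zero \<Rightarrow> 'f \<times> 'h) \<Rightarrow> 'e \<Rightarrow> 'f" where
  "blockA U x = fst (U (x, 0))"

definition blockB :: "('e :: zero \<times> 'h :: zero \<Rightarrow> 'f \<times> 'h) \<Rightarrow> 'h \<Rightarrow> 'f" where
  "blockB U h = fst (U (0, h))"

definition blockC :: "('e :: zero \<times> 'h :: zero \<Rightarrow> 'f \<times> 'h) \<Rightarrow> 'e \<Rightarrow> 'h" where
  "blockC U x = snd (U (x, 0))"

definition blockD :: "('e :: zero \<times> 'h :: zero \<Rightarrow> 'f \<times> 'h) \<Rightarrow> 'h \<Rightarrow> 'h" where
  "blockD U h = snd (U (0, h))"

text \<open>The value \<open>None\<close> marks the points at which the function is not defined.\<close>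

definition characteristic_function ::
    "('e :: chilbert_space \<times> 'h :: chilbert_space \<Rightarrow> 'f :: chilbert_space \<times> 'h)
      \<Rightarrow> complex \<Rightarrow> ('e \<Rightarrow> 'f) option" where
  "characteristic_function U z =
     (let T = (\<lambda>h. h - z *\<^sub>C blockD U h)
      in if invertible_operator T
         then Some (\<lambda>x. blockA U x + z *\<^sub>C blockB U (inv T (blockC U x)))
         else None)"


section \<open>Operator-valued rational functions\<close>

definition operator_polynomial ::
    "(complex \<Rightarrow> 'a :: complex_inner \<Rightarrow> 'b :: complex_inner) \<Rightarrow> bool" where
  "operator_polynomial P \<longleftrightarrow>
     (\<exists>n T. (\<forall>k. bounded_operator (T k)) \<and> (\<forall>z x. P z x = (\<Sum>k\<le>n. z ^ k *\<^sub>C T k x)))"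

text \<open>
  \<open>S = P / q\<close> holds on the whole domain of definition of \<open>S\<close>, which omits only finitely many points.
  The quotient \<open>P / q\<close> may have a larger domain: a rational function is regarded as defined wherever
  one of its representations is.
\<close>

definition rational_representation ::
    "(complex \<Rightarrow> ('a :: complex_inner \<Rightarrow> 'b :: complex_inner) option)
      \<Rightarrow> (complex \<Rightarrow> 'a \<Rightarrow> 'b) \<Rightarrow> complex poly \<Rightarrow> bool" where
  "rational_representation S P q \<longleftrightarrow>
     finite {z. S z = None} \<and> operator_polynomial P \<and> q \<noteq> 0 \<and>
     (\<forall>z T. S z = Some T \<longrightarrow>
        poly q z \<noteq> 0 \<and> T = (\<lambda>x. inverse (poly q z) *\<^sub>C P z x))"

definition rational_function ::
    "(complex \<Rightarrow> ('a :: complex_inner \<Rightarrow> 'b :: complex_inner) option) \<Rightarrow> bool" where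
  "rational_function S \<longleftrightarrow> (\<exists>P q. rational_representation S P q)"

definition singularity ::
    "(complex \<Rightarrow> ('a :: complex_inner \<Rightarrow> 'b :: complex_inner) option) \<Rightarrow> complex \<Rightarrow> bool" where
  "singularity S z \<longleftrightarrow> \<not> (\<exists>P q. rational_representation S P q \<and> poly q z \<noteq> 0)"

definition rational_value ::
    "(complex \<Rightarrow> ('a :: complex_inner \<Rightarrow> 'b :: complex_inner) option)
      \<Rightarrow> complex \<Rightarrow> 'a \<Rightarrow> 'b" where
  "rational_value S z =
     (THE T. \<exists>P q. rational_representation S P q \<and> poly q z \<noteq> 0 \<and>
                   T = (\<lambda>x. inverse (poly q z) *\<^sub>C P z x))"

lemma continuous_scaleC:
  fixes f :: "'c :: t2_space \<Rightarrow> complex" and g :: "'c \<Rightarrow> 'b :: complex_inner"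
  assumes "continuous F f" "continuous F g"
  shows "continuous F (\<lambda>w. f w *\<^sub>C g w)"
proof -
  have bl: "bounded_linear (\<lambda>v :: 'b. \<i> *\<^sub>C v)"
  proof (rule bounded_linear_intro[of _ 1])
    fix v w :: 'b and r :: real
    show "\<i> *\<^sub>C (v + w) = \<i> *\<^sub>C v + \<i> *\<^sub>C w" by (rule scaleC_add_right)
    show "\<i> *\<^sub>C (r *\<^sub>R v) = r *\<^sub>R (\<i> *\<^sub>C v)"
      by (simp add: scaleR_eq_scaleC scaleC_scaleC mult.commute)
    have "cinner (\<i> *\<^sub>C v) (\<i> *\<^sub>C v) = \<i> * cnj (\<i> * cinner v v)"
      by (metis cinner_scaleC_left cinner_commute)
    also have "\<dots> = cinner v v"
      using cinner_commute[of v v] by simp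
    finally show "norm (\<i> *\<^sub>C v) \<le> norm v * 1"
      by (simp add: norm_eq_sqrt_inner inner_eq_Re_cinner)
  qed
  have "f w *\<^sub>C g w = Re (f w) *\<^sub>R g w + Im (f w) *\<^sub>R (\<i> *\<^sub>C g w)" for w
  proof -
    have "f w = complex_of_real (Re (f w)) + complex_of_real (Im (f w)) * \<i>"
      by (metis complex_eq mult.commute)
    then show ?thesis
      by (metis scaleC_add_left scaleC_scaleC scaleR_eq_scaleC)
  qed
  then show ?thesis
    by (simp add: continuous_add continuous_scaleR continuous_Re continuous_Im assms
        bounded_linear.continuous[OF bl])
qed

lemma isCont_operator_polynomial:
  assumes "operator_polynomial P"
  shows "isCont (\<lambda>w. P w x) z"
proof -
  from assms obtain n T where "P = (\<lambda>z x. \<Sum>k\<le>n. z ^ k *\<^sub>C T k x)"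
    unfolding operator_polynomial_def by blast
  then show ?thesis
    by (simp add: continuous_sum continuous_scaleC continuous_power)
qed

text \<open>The value at a regular point does not depend on the representation.\<close>

lemma rational_value_eq:
  fixes S :: "complex \<Rightarrow> ('a :: complex_inner \<Rightarrow> 'b :: complex_inner) option"
  assumes "rational_representation S P q" "poly q z \<noteq> 0"
  shows "rational_value S z = (\<lambda>x. inverse (poly q z) *\<^sub>C P z x)"
proof -
  have "inverse (poly q' z) *\<^sub>C P' z x = inverse (poly q z) *\<^sub>C P z x"
    if r': "rational_representation S P' q'" and q': "poly q' z \<noteq> 0" for P' q' x
  proof -
    let ?f = "\<lambda>w. inverse (poly q w) *\<^sub>C P w x" and ?g = "\<lambda>w. inverse (poly q' w) *\<^sub>C P' w x"
    have "isCont ?f z" "isCont ?g z"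
      using assms r' q' isCont_operator_polynomial[of P _ x] isCont_operator_polynomial[of P' _ x]
      by (simp_all add: rational_representation_def continuous_scaleC continuous_at_within_inverse)
    then have lim: "?f \<midarrow>z\<rightarrow> ?f z" "?g \<midarrow>z\<rightarrow> ?g z"
      by (auto simp: isCont_def)
    have "finite {w. S w = None}"
      using r' by (simp add: rational_representation_def)
    then have "\<forall>\<^sub>F w in at z. w \<notin> {w. S w = None}"
      using islimpt_finite[of _ z] islimpt_iff_eventually by blast
    then have "\<forall>\<^sub>F w in at z. ?f w = ?g w"
    proof (rule eventually_mono)
      fix w assume "w \<notin> {w. S w = None}"
      then obtain T where "S w = Some T" by auto
      then have "T = (\<lambda>x. inverse (poly q w) *\<^sub>C P w x)"
        "T = (\<lambda>x. inverse (poly q' w) *\<^sub>C P' w x)"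
        using assms(1) r' unfolding rational_representation_def by blast+
      then show "?f w = ?g w" by metis
    qed
    then have "?g \<midarrow>z\<rightarrow> ?f z"
      using lim(1) by (rule Lim_transform_eventually[rotated])
    then show ?thesis
      using lim(2) tendsto_unique[OF trivial_limit_at] by blast
  qed
  then show ?thesis
    unfolding rational_value_def using assms by (intro the_equality) (blast, fast)
qed

definition rational_inner_function ::
    "(complex \<Rightarrow> ('a :: chilbert_space \<Rightarrow> 'b :: chilbert_space) option) \<Rightarrow> bool" where
  "rational_inner_function S \<longleftrightarrow>
     finite_dimensional TYPE('a) \<and> finite_dimensional TYPE('b) \<and>
     rational_function S \<and>
     (\<forall>z. norm z \<le> 1 \<longrightarrow> \<not> singularity S z) \<and>
     (\<forall>z. norm z < 1 \<longrightarrow>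
        positive_operator (\<lambda>x. x - cadjoint (rational_value S z) (rational_value S z x)) \<and>
        positive_operator (\<lambda>y. y - rational_value S z (cadjoint (rational_value S z) y))) \<and>
     (\<forall>t. norm t = 1 \<longrightarrow>
        (\<lambda>x. x - cadjoint (rational_value S t) (rational_value S t x)) = (\<lambda>x. 0) \<and>
        (\<lambda>y. y - rational_value S t (cadjoint (rational_value S t) y)) = (\<lambda>y. 0))"

end

theory Submission
  imports Defs
begin

text \<open>
  For isometric \<open>U\<close> and \<open>I - z D\<close> invertible, the vector \<open>k = (I - z D)\<^sup>-\<^sup>1 C x\<close> satisfies
  \<open>U (x, z k) = (S(z) x, k)\<close>, whence
  \<open>\<parallel>S(z) x\<parallel>\<^sup>2 = \<parallel>x\<parallel>\<^sup>2 - (1 - \<bar>z\<bar>\<^sup>2) \<parallel>k\<parallel>\<^sup>2\<close>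
  (\<open>characteristic_function_state\<close>, \<open>characteristic_function_norm\<close>). As \<open>D\<close> is a contraction,
  \<open>S\<close> is defined throughout the open disc, and is contractive there; it is isometric at those points
  of the circle at which it is defined. What remains is to show that \<open>S\<close> is rational, to treat the
  points \<open>t\<close> of the circle with \<open>1/t\<close> an eigenvalue of \<open>D\<close>, and to pass from isometric to unitary.

  Rationality is obtained without determinants. A linear relation between \<open>x, D x, D\<^sup>2 x, \<dots>\<close> yields a
  polynomial \<open>q \<noteq> 0\<close> and a vector polynomial \<open>r\<close> with \<open>(I - z D) r(z) = q(z) x\<close>
  (\<open>resolvent_vector\<close>). Letting \<open>x\<close> run through a basis gives an operator polynomial \<open>R\<close> with
  \<open>(I - z D) R(z) = q(z) I\<close>, and cancelling linear factors achieves \<open>q(z) \<noteq> 0\<close> wherever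
  \<open>I - z D\<close> is invertible (\<open>resolvent_pair_reduced\<close>). Hence \<open>S = P / q\<close> with an operator polynomial \<open>P\<close>.

  If \<open>q(t) = 0\<close> with \<open>\<bar>t\<bar> = 1\<close>, then \<open>\<parallel>P(z) x\<parallel> \<le> \<bar>q(z)\<bar> \<parallel>x\<parallel>\<close> in the disc forces \<open>P(t) = 0\<close>, so
  \<open>z - t\<close> divides both \<open>P\<close> and \<open>q\<close>. After finitely many cancellations \<open>q\<close> has no zeros in the closed
  disc (\<open>rational_representation_closed_disc\<close>), and by continuity \<open>S(t)\<close> is isometric at every point
  of the circle. For surjectivity, the same argument for the unitary colligation \<open>U\<^sup>*\<close>, whose
  characteristic function has values from the output to the input space, provides a linear isometry
  \<open>J\<close> in that direction; \<open>J S(t)\<close> is an injective endomorphism of a finite-dimensional space, hence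
  onto, and therefore so is \<open>S(t)\<close>.
\<close>

section \<open>Linear algebra in complex inner product spaces\<close>

abbreviation clinear :: "('a :: complex_inner \<Rightarrow> 'b :: complex_inner) \<Rightarrow> bool" where
  "clinear \<equiv> Vector_Spaces.linear scaleC scaleC"

lemma clinear_iff:
  "clinear T \<longleftrightarrow> (\<forall>x y. T (x + y) = T x + T y) \<and> (\<forall>c x. T (c *\<^sub>C x) = c *\<^sub>C T x)"
  by (simp add: Vector_Spaces.linear_iff vector_space_scaleC)

lemma scaleC_zero_left [simp]: "0 *\<^sub>C (x :: 'a :: complex_inner) = 0"
  using scaleC_add_left[of 0 0 x] by simp

lemma scaleC_zero_right [simp]: "c *\<^sub>C (0 :: 'a :: complex_inner) = 0"
  using scaleC_add_right[of c 0 0] by simp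

lemma scaleC_diff_right: "c *\<^sub>C (x - y :: 'a :: complex_inner) = c *\<^sub>C x - c *\<^sub>C y"
  by (metis scaleC_add_right add_diff_cancel_right' diff_add_cancel)

lemma scaleC_sum_right: "c *\<^sub>C (\<Sum>i\<in>I. f i :: 'a :: complex_inner) = (\<Sum>i\<in>I. c *\<^sub>C f i)"
  by (induction I rule: infinite_finite_induct) (simp_all add: scaleC_add_right)

lemma scaleC_sum_left: "(\<Sum>i\<in>I. f i) *\<^sub>C (x :: 'a :: complex_inner) = (\<Sum>i\<in>I. f i *\<^sub>C x)"
  by (induction I rule: infinite_finite_induct) (simp_all add: scaleC_add_left)

lemma scaleC_inverse_cancel:
  "a \<noteq> 0 \<Longrightarrow> inverse a *\<^sub>C a *\<^sub>C (x :: 'a :: complex_inner) = x"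
  "a \<noteq> 0 \<Longrightarrow> a *\<^sub>C inverse a *\<^sub>C (x :: 'a :: complex_inner) = x"
  by (simp_all add: scaleC_scaleC scaleC_one)

lemma cinner_add_right: "cinner x (y + z) = cinner x y + cinner x z"
  by (metis cinner_add_left cinner_commute complex_cnj_add)

lemma cinner_scaleC_right: "cinner x (c *\<^sub>C y) = cnj c * cinner x y"
  by (metis cinner_scaleC_left cinner_commute complex_cnj_mult)

lemma cinner_zero_left [simp]: "cinner 0 y = 0"
  using cinner_add_left[of 0 0 y] by simp

lemma cinner_zero_right [simp]: "cinner x 0 = 0"
  using cinner_add_right[of x 0 0] by simp

lemma cinner_diff_left: "cinner (x - y) z = cinner x z - cinner y z"
  by (metis cinner_add_left add_diff_cancel_right' diff_add_cancel)

lemma cinner_sum_left: "cinner (\<Sum>i\<in>I. f i) y = (\<Sum>i\<in>I. cinner (f i) y)"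
  by (induction I rule: infinite_finite_induct) (simp_all add: cinner_add_left)

lemma cinner_sum_right: "cinner x (\<Sum>i\<in>I. f i) = (\<Sum>i\<in>I. cinner x (f i))"
  by (induction I rule: infinite_finite_induct) (simp_all add: cinner_add_right)

lemma cinner_self: "cinner x x = complex_of_real ((norm x)\<^sup>2)"
proof -
  have "Im (cinner x x) = 0"
    using cinner_commute[of x x] by (metis Reals_cnj_iff complex_is_Real_iff)
  moreover have "Re (cinner x x) = (norm x)\<^sup>2"
    by (metis inner_eq_Re_cinner power2_norm_eq_inner)
  ultimately show ?thesis
    by (simp add: complex_eq_iff)
qed

lemma norm_scaleC: "norm (c *\<^sub>C (x :: 'a :: complex_inner)) = norm c * norm x"
proof -
  have "complex_of_real ((norm (c *\<^sub>C x))\<^sup>2) = complex_of_real ((norm c * norm x)\<^sup>2)"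
    unfolding cinner_self[symmetric] cinner_scaleC_left cinner_scaleC_right
    by (simp add: cinner_self complex_norm_square[symmetric] algebra_simps)
  then have "(norm (c *\<^sub>C x))\<^sup>2 = (norm c * norm x)\<^sup>2"
    using of_real_eq_iff by blast
  then show ?thesis
    by simp
qed

lemma cinner_ext: "(\<And>y. cinner x y = cinner x' y) \<Longrightarrow> x = x'"
proof -
  assume "\<And>y. cinner x y = cinner x' y"
  then have "cinner (x - x') (x - x') = 0"
    by (simp add: cinner_diff_left)
  then show "x = x'"
    by (simp add: cinner_self)
qed

lemma clinearI:
  assumes "\<And>x y. T (x + y) = T x + T y" "\<And>c x. T (c *\<^sub>C x) = c *\<^sub>C T x"
  shows "clinear T"
  using assms by (simp add: clinear_iff)

lemma clinear_add: "clinear T \<Longrightarrow> T (x + y) = T x + T y"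
  and clinear_scaleC: "clinear T \<Longrightarrow> T (c *\<^sub>C x) = c *\<^sub>C T x"
  by (simp_all add: clinear_iff)

lemma clinear_zero: "clinear T \<Longrightarrow> T 0 = 0"
  by (metis clinear_scaleC scaleC_zero_left)

lemma clinear_diff: "clinear T \<Longrightarrow> T (x - y) = T x - T y"
  by (metis clinear_add add_diff_cancel_right' diff_add_cancel)

lemma clinear_sum: "clinear T \<Longrightarrow> T (\<Sum>i\<in>I. f i) = (\<Sum>i\<in>I. T (f i))"
  by (induction I rule: infinite_finite_induct) (simp_all add: clinear_zero clinear_add)

lemma clinear_inj_iff: "clinear T \<Longrightarrow> inj T \<longleftrightarrow> (\<forall>x. T x = 0 \<longrightarrow> x = 0)"
  unfolding inj_def by (metis clinear_diff clinear_zero eq_iff_diff_eq_0)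

text \<open>
  A finite Parseval frame is what is used of an orthonormal basis: it makes coordinates available
  without any appeal to linear independence.
\<close>

definition parseval :: "'a :: complex_inner set \<Rightarrow> bool" where
  "parseval E \<longleftrightarrow> finite E \<and> (\<forall>x. x = (\<Sum>e\<in>E. cinner x e *\<^sub>C e))"

lemma parsevalD:
  assumes "parseval E"
  shows "finite E" and "(\<Sum>e\<in>E. cinner x e *\<^sub>C e) = x"
  using assms unfolding parseval_def by metis+

lemma finite_dimensional_parseval:
  assumes "finite_dimensional TYPE('a :: complex_inner)"
  obtains E :: "'a :: complex_inner set" where "parseval E"
proof -
  interpret vector_space "scaleC :: complex \<Rightarrow> 'a \<Rightarrow> 'a"
    by (rule vector_space_scaleC)
  from assms obtain B :: "'a set" where B: "finite B" "span B = UNIV"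
    unfolding finite_dimensional_def by blast
  let ?ok = "\<lambda>E x. x = (\<Sum>e\<in>E. cinner x e *\<^sub>C e)"
  have "\<exists>E. finite E \<and> (\<forall>e\<in>E. \<forall>e'\<in>E. cinner e e' = (if e = e' then 1 else 0)) \<and> (\<forall>x\<in>B. ?ok E x)"
    using \<open>finite B\<close>
  proof (induction B)
    case empty
    then show ?case by (intro exI[of _ "{}"]) simp
  next
    case (insert a B)
    then obtain E where E: "finite E" "\<And>e e'. e \<in> E \<Longrightarrow> e' \<in> E \<Longrightarrow> cinner e e' = (if e = e' then 1 else 0)"
      "\<And>x. x \<in> B \<Longrightarrow> ?ok E x"
      by metis
    \<comment> \<open>one Gram-Schmidt step: \<open>r\<close> is the component of \<open>a\<close> orthogonal to \<open>E\<close>\<close>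
    define r where "r = a - (\<Sum>e\<in>E. cinner a e *\<^sub>C e)"
    have r_orth: "cinner r e = 0" if "e \<in> E" for e
    proof -
      have "(\<Sum>e'\<in>E. cinner a e' * cinner e' e) = (\<Sum>e'\<in>E. if e' = e then cinner a e else 0)"
        by (intro sum.cong) (auto simp: E(2) that)
      then show ?thesis
        using that E(1) by (simp add: r_def cinner_diff_left cinner_sum_left cinner_scaleC_left)
    qed
    show ?case
    proof (cases "r = 0")
      case True
      then have "?ok E a" by (simp add: r_def)
      then show ?thesis using E by (intro exI[of _ E]) auto
    next
      case False
      define u where "u = complex_of_real (inverse (norm r)) *\<^sub>C r"
      have u_orth: "cinner u e = 0" "cinner e u = 0" if "e \<in> E" for e
      proof -
        show "cinner u e = 0" by (simp add: u_def cinner_scaleC_left r_orth[OF that])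
        then show "cinner e u = 0" by (metis cinner_commute complex_cnj_zero)
      qed
      have ru: "r = complex_of_real (norm r) *\<^sub>C u"
        using False by (simp add: u_def scaleC_scaleC scaleC_one flip: of_real_mult)
      have uu: "cinner u u = 1"
        using False by (simp add: cinner_self u_def norm_scaleC norm_inverse)
      then have "u \<notin> E" using u_orth by fastforce
      have ok: "?ok (insert u E) x" if "?ok E x" for x
      proof -
        have "cinner x u = (\<Sum>e\<in>E. cinner x e * cinner e u)"
          by (subst that) (simp add: cinner_sum_left cinner_scaleC_left)
        then have "cinner x u = 0" by (simp add: u_orth)
        then show ?thesis using that E(1) \<open>u \<notin> E\<close> by simp
      qed
      have a: "a = r + (\<Sum>e\<in>E. cinner a e *\<^sub>C e)" by (simp add: r_def)
      have "cinner a u = cinner r u + (\<Sum>e\<in>E. cinner a e * cinner e u)"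
        by (subst a) (simp add: cinner_add_left cinner_sum_left cinner_scaleC_left)
      also have "\<dots> = complex_of_real (norm r)"
        by (subst ru) (simp add: u_orth cinner_scaleC_left uu)
      finally have "?ok (insert u E) a"
        using a ru E(1) \<open>u \<notin> E\<close> by simp
      then show ?thesis
        using E ok uu u_orth \<open>u \<notin> E\<close> by (intro exI[of _ "insert u E"]) auto
    qed
  qed
  then obtain E where E: "finite E" "\<forall>x\<in>B. ?ok E x" by metis
  have "?ok E x" for x
  proof -
    have "x \<in> span B" using B by simp
    then show ?thesis
    proof (induction rule: span_induct_alt)
      case base
      then show ?case by simp
    next
      case (step c x y)
      have "(\<Sum>e\<in>E. cinner (c *\<^sub>C x + y) e *\<^sub>C e)
          = c *\<^sub>C (\<Sum>e\<in>E. cinner x e *\<^sub>C e) + (\<Sum>e\<in>E. cinner y e *\<^sub>C e)"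
        by (simp add: cinner_add_left cinner_scaleC_left scaleC_add_left sum.distrib
            scaleC_sum_right scaleC_scaleC)
      then show ?case using step E(2) by metis
    qed
  qed
  then show ?thesis using that[of E] E(1) by (simp add: parseval_def)
qed

lemma clinear_parseval_expand:
  assumes "parseval E" "clinear T"
  shows "T x = (\<Sum>e\<in>E. cinner x e *\<^sub>C T e)"
  using clinear_sum[OF assms(2), of "\<lambda>e. cinner x e *\<^sub>C e" E]
  by (simp add: parsevalD(2)[OF assms(1)] clinear_scaleC[OF assms(2)])

lemma bounded_operator_if_clinear:
  fixes T :: "'a :: complex_inner \<Rightarrow> 'b :: complex_inner"
  assumes "finite_dimensional TYPE('a)" "clinear T"
  shows "bounded_operator T"
proof -
  obtain E :: "'a set" where E: "parseval E"
    using finite_dimensional_parseval[OF assms(1)] .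
  have "bounded_linear T"
  proof (rule bounded_linear_intro[where K = "\<Sum>e\<in>E. norm e * norm (T e)"])
    fix x
    have "norm (T x) \<le> (\<Sum>e\<in>E. norm (cinner x e *\<^sub>C T e))"
      by (subst clinear_parseval_expand[OF E assms(2)]) (rule norm_sum)
    also have "\<dots> \<le> (\<Sum>e\<in>E. norm x * norm e * norm (T e))"
    proof (rule sum_mono)
      fix e
      \<comment> \<open>Cauchy-Schwarz for the complex inner product, from the real one after rotating the phase\<close>
      have "norm (cinner x e) \<le> norm x * norm e"
      proof (cases "cinner x e = 0")
        case False
        define u where "u = cnj (cinner x e) / complex_of_real (norm (cinner x e))"
        have "cnj (cinner x e) * cinner x e = complex_of_real ((norm (cinner x e))\<^sup>2)"
          by (metis complex_norm_square mult.commute)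
        then have "cinner (u *\<^sub>C x) e = complex_of_real (norm (cinner x e))"
          using False by (simp add: u_def cinner_scaleC_left power2_eq_square)
        then have "norm (cinner x e) = inner (u *\<^sub>C x) e"
          by (simp add: inner_eq_Re_cinner)
        also have "\<dots> \<le> norm (u *\<^sub>C x) * norm e"
          by (rule norm_cauchy_schwarz)
        also have "\<dots> = norm x * norm e"
          using False by (simp add: norm_scaleC u_def norm_divide)
        finally show ?thesis .
      qed simp
      then show "norm (cinner x e *\<^sub>C T e) \<le> norm x * norm e * norm (T e)"
        by (simp add: norm_scaleC mult_right_mono)
    qed
    finally show "norm (T x) \<le> norm x * (\<Sum>e\<in>E. norm e * norm (T e))"
      by (simp add: sum_distrib_left mult.assoc)
  qed (simp_all add: clinear_add[OF assms(2)] clinear_scaleC[OF assms(2)] scaleR_eq_scaleC)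
  then show ?thesis using assms(2) by (simp add: bounded_operator_def)
qed

lemma cinner_cadjoint:
  fixes T :: "'a :: complex_inner \<Rightarrow> 'b :: complex_inner"
  assumes "finite_dimensional TYPE('a)" "clinear T"
  shows "cinner (T x) y = cinner x (cadjoint T y)"
proof -
  obtain E :: "'a set" where E: "parseval E"
    using finite_dimensional_parseval[OF assms(1)] .
  have "cinner (T x) y = cinner x (\<Sum>e\<in>E. cnj (cinner (T e) y) *\<^sub>C e)" for x y
    by (subst clinear_parseval_expand[OF E assms(2)])
      (simp add: cinner_sum_left cinner_sum_right cinner_scaleC_left cinner_scaleC_right mult.commute)
  then have "\<exists>T'. \<forall>x y. cinner (T x) y = cinner x (T' y)"
    by (intro exI[of _ "\<lambda>y. \<Sum>e\<in>E. cnj (cinner (T e) y) *\<^sub>C e"]) blast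
  then have "\<forall>x y. cinner (T x) y = cinner x (cadjoint T y)"
    unfolding cadjoint_def by (rule someI_ex)
  then show ?thesis by blast
qed

lemma clinear_cadjoint:
  fixes T :: "'a :: complex_inner \<Rightarrow> 'b :: complex_inner"
  assumes "finite_dimensional TYPE('a)" "clinear T"
  shows "clinear (cadjoint T)"
proof (rule clinearI)
  note adj = cinner_cadjoint[OF assms]
  have adj': "cinner (cadjoint T y) x = cinner y (T x)" for x y
    by (metis adj cinner_commute)
  show "cadjoint T (x + y) = cadjoint T x + cadjoint T y" for x y
    by (rule cinner_ext) (simp add: adj' cinner_add_left)
  show "cadjoint T (c *\<^sub>C x) = c *\<^sub>C cadjoint T x" for c x
    by (rule cinner_ext) (simp add: adj' cinner_scaleC_left)
qed

lemma finite_dimensional_prod: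
  assumes "finite_dimensional TYPE('a :: complex_inner)" "finite_dimensional TYPE('b :: complex_inner)"
  shows "finite_dimensional TYPE('a \<times> 'b)"
proof -
  interpret vector_space "scaleC :: complex \<Rightarrow> 'a \<times> 'b \<Rightarrow> 'a \<times> 'b"
    by (rule vector_space_scaleC)
  obtain E :: "'a set" where E: "parseval E"
    using finite_dimensional_parseval[OF assms(1)] .
  obtain F :: "'b set" where F: "parseval F"
    using finite_dimensional_parseval[OF assms(2)] .
  let ?G = "(\<lambda>e. (e, 0)) ` E \<union> (\<lambda>f. (0, f)) ` F"
  have lin: "clinear (\<lambda>x :: 'a. (x, 0 :: 'b))" "clinear (\<lambda>y :: 'b. (0 :: 'a, y))"
    by (auto intro!: clinearI simp: scaleC_prod_def)
  have "p \<in> span ?G" for p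
  proof -
    have "p = (\<Sum>e\<in>E. cinner (fst p) e *\<^sub>C (e, 0)) + (\<Sum>f\<in>F. cinner (snd p) f *\<^sub>C (0, f))"
      using clinear_parseval_expand[OF E lin(1), of "fst p"]
        clinear_parseval_expand[OF F lin(2), of "snd p"]
      by (metis add.left_neutral add.right_neutral add_Pair prod.collapse)
    then show ?thesis
      by (metis (no_types, lifting) UnI1 UnI2 imageI span_add span_base span_scale span_sum)
  qed
  then show ?thesis
    unfolding finite_dimensional_def
    using parsevalD(1)[OF E] parsevalD(1)[OF F] by (intro exI[of _ ?G]) auto
qed

lemma finite_dimensional_vector_spaceE:
  assumes "finite_dimensional TYPE('a :: complex_inner)"
  obtains B where "finite_dimensional_vector_space (scaleC :: complex \<Rightarrow> 'a \<Rightarrow> 'a) B"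
proof -
  interpret vector_space "scaleC :: complex \<Rightarrow> 'a \<Rightarrow> 'a"
    by (rule vector_space_scaleC)
  from assms obtain S :: "'a set" where S: "finite S" "span S = UNIV"
    unfolding finite_dimensional_def by blast
  obtain B where B: "B \<subseteq> S" "independent B" "S \<subseteq> span B"
    by (rule maximal_independent_subset)
  have "span B = UNIV"
    using B(3) S(2) by (metis span_mono span_span top.extremum_unique)
  then show ?thesis
    using B S(1) by (intro that[of B]) (simp add: finite_dimensional_vector_space_def
      finite_dimensional_vector_space_axioms_def vector_space_axioms finite_subset)
qed

text \<open>Injective and surjective endomorphisms of a finite-dimensional space coincide.\<close>

lemma clinear_inj_imp_surj:
  fixes T :: "'a :: complex_inner \<Rightarrow> 'a"
  assumes "finite_dimensional TYPE('a)" "clinear T" "inj T"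
  shows "surj T"
proof -
  obtain B where "finite_dimensional_vector_space (scaleC :: complex \<Rightarrow> 'a \<Rightarrow> 'a) B"
    using finite_dimensional_vector_spaceE[OF assms(1)] .
  then interpret finite_dimensional_vector_space_pair
    "scaleC :: complex \<Rightarrow> 'a \<Rightarrow> 'a" B "scaleC :: complex \<Rightarrow> 'a \<Rightarrow> 'a" B
    by (simp add: finite_dimensional_vector_space_pair_def)
  show ?thesis
    using linear_injective_imp_surjective[OF assms(2,3)] by simp
qed

lemma clinear_surj_imp_inj:
  fixes T :: "'a :: complex_inner \<Rightarrow> 'a"
  assumes "finite_dimensional TYPE('a)" "clinear T" "surj T"
  shows "inj T"
proof -
  obtain B where "finite_dimensional_vector_space (scaleC :: complex \<Rightarrow> 'a \<Rightarrow> 'a) B"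
    using finite_dimensional_vector_spaceE[OF assms(1)] .
  then interpret finite_dimensional_vector_space_pair
    "scaleC :: complex \<Rightarrow> 'a \<Rightarrow> 'a" B "scaleC :: complex \<Rightarrow> 'a \<Rightarrow> 'a" B
    by (simp add: finite_dimensional_vector_space_pair_def)
  show ?thesis
    using linear_surjective_imp_injective[OF assms(2,3)] by simp
qed

lemma invertible_operator_iff_inj:
  fixes T :: "'a :: complex_inner \<Rightarrow> 'a"
  assumes "finite_dimensional TYPE('a)" "clinear T"
  shows "invertible_operator T \<longleftrightarrow> inj T"
proof
  assume "invertible_operator T"
  then show "inj T"
    unfolding invertible_operator_def by (metis inj_on_id inj_on_imageI2)
next
  assume inj: "inj T"
  then have surj: "surj T" by (rule clinear_inj_imp_surj[OF assms])
  have "clinear (inv T)"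
    by (rule clinearI; rule inv_f_eq[OF inj])
      (simp_all add: clinear_add[OF assms(2)] clinear_scaleC[OF assms(2)] surj_f_inv_f[OF surj])
  then show "invertible_operator T"
    unfolding invertible_operator_def
    using bounded_operator_if_clinear[OF assms(1)] inj surj
    by (intro exI[of _ "inv T"]) (auto simp: fun_eq_iff surj_f_inv_f)
qed

text \<open>
  Sufficiently many of the vectors \<open>x, T x, T\<^sup>2 x, \<dots>\<close> satisfy a nontrivial linear relation. Repetitions
  among them are treated separately, since linear dependence is a property of sets.
\<close>

lemma iterates_linear_relation:
  fixes T :: "'a :: complex_inner \<Rightarrow> 'a"
  assumes "finite_dimensional TYPE('a)"
  obtains n a where "\<exists>k\<le>n. a k \<noteq> 0" "(\<Sum>k\<le>n. a k *\<^sub>C (T ^^ k) x) = 0"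
proof -
  obtain B where "finite_dimensional_vector_space (scaleC :: complex \<Rightarrow> 'a \<Rightarrow> 'a) B"
    using finite_dimensional_vector_spaceE[OF assms] .
  then interpret finite_dimensional_vector_space "scaleC :: complex \<Rightarrow> 'a \<Rightarrow> 'a" B .
  let ?v = "\<lambda>k. (T ^^ k) x" and ?n = "card B"
  show ?thesis
  proof (cases "inj_on ?v {..?n}")
    case False
    then obtain i j where ij: "i \<le> ?n" "j \<le> ?n" "i \<noteq> j" "?v i = ?v j"
      by (auto simp: inj_on_def)
    define a where "a k = (if k = i then 1 else if k = j then -1 else 0 :: complex)" for k
    have "(\<Sum>k\<le>?n. a k *\<^sub>C ?v k) = (\<Sum>k\<in>{i, j}. a k *\<^sub>C ?v k)"
      using ij by (intro sum.mono_neutral_right) (auto simp: a_def)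
    also have "\<dots> = (1 + -1) *\<^sub>C ?v i"
      unfolding scaleC_add_left using ij by (simp add: a_def)
    finally show ?thesis
      using that[of ?n a] ij by (metis a_def scaleC_zero_left add.right_inverse zero_neq_one)
  next
    case True
    have "dependent (?v ` {..?n})"
    proof (rule ccontr)
      assume "independent (?v ` {..?n})"
      from independent_span_bound[OF finite_Basis this] show False
        by (simp add: span_Basis card_image[OF True])
    qed
    then obtain u where u: "\<exists>k\<le>?n. u (?v k) \<noteq> 0" "(\<Sum>v\<in>?v ` {..?n}. u v *\<^sub>C v) = 0"
      by (auto simp: dependent_finite)
    then show ?thesis
      by (intro that[of ?n "\<lambda>k. u (?v k)"]) (simp_all add: sum.reindex[OF True])
  qed
qed


section \<open>Polynomial operator functions\<close>

text \<open>Scalar functions on the whole plane that are given by a polynomial.\<close>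

definition polyfun :: "(complex \<Rightarrow> complex) \<Rightarrow> bool" where
  "polyfun f \<longleftrightarrow> (\<exists>p. \<forall>z. f z = poly p z)"

lemma polyfun_poly: "polyfun (poly p)"
  by (auto simp: polyfun_def)

lemma polyfun_const: "polyfun (\<lambda>z. c)"
  by (auto simp: polyfun_def intro: exI[of _ "[:c:]"])

lemma polyfun_id: "polyfun (\<lambda>z. z)"
  by (auto simp: polyfun_def intro: exI[of _ "[:0, 1:]"])

lemma polyfun_add: "polyfun f \<Longrightarrow> polyfun g \<Longrightarrow> polyfun (\<lambda>z. f z + g z)"
  unfolding polyfun_def by (metis poly_add)

lemma polyfun_diff: "polyfun f \<Longrightarrow> polyfun g \<Longrightarrow> polyfun (\<lambda>z. f z - g z)"
  unfolding polyfun_def by (metis poly_diff)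

lemma polyfun_mult: "polyfun f \<Longrightarrow> polyfun g \<Longrightarrow> polyfun (\<lambda>z. f z * g z)"
  unfolding polyfun_def by (metis poly_mult)

lemma polyfun_power: "polyfun f \<Longrightarrow> polyfun (\<lambda>z. f z ^ n)"
  by (induction n) (auto intro: polyfun_const polyfun_mult)

lemma polyfun_sum: "(\<And>i. i \<in> I \<Longrightarrow> polyfun (f i)) \<Longrightarrow> polyfun (\<lambda>z. \<Sum>i\<in>I. f i z)"
  by (induction I rule: infinite_finite_induct) (auto intro: polyfun_const polyfun_add)

lemma polyfun_prod: "(\<And>i. i \<in> I \<Longrightarrow> polyfun (f i)) \<Longrightarrow> polyfun (\<lambda>z. \<Prod>i\<in>I. f i z)"
  by (induction I rule: infinite_finite_induct) (auto intro: polyfun_const polyfun_mult)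

lemmas polyfun_intros = polyfun_poly polyfun_const polyfun_id polyfun_add polyfun_diff
  polyfun_mult polyfun_power polyfun_sum polyfun_prod

text \<open>Cancellation of a factor \<open>z - z0\<close> remains valid at \<open>z0\<close> itself.\<close>

lemma polyfun_cancel:
  assumes "polyfun f" "\<And>z. (z - z0) * f z = 0"
  shows "f z = 0"
proof -
  from assms(1) obtain p where p: "\<And>z. f z = poly p z"
    by (auto simp: polyfun_def)
  have "\<forall>z. poly ([:- z0, 1:] * p) z = 0"
    using assms(2) p by (simp add: algebra_simps)
  then have "[:- z0, 1:] * p = 0"
    unfolding poly_all_0_iff_0 .
  then have "p = 0"
    by (metis mult_eq_0_iff one_neq_zero pCons_eq_0_iff)
  then show ?thesis
    using p by simp
qed

text \<open>
  Operator polynomials between finite-dimensional spaces, described through matrix entries. In this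
  form closure properties and division by a linear factor reduce to scalar polynomials.
\<close>

definition weakly_polynomial ::
    "(complex \<Rightarrow> 'a :: complex_inner \<Rightarrow> 'b :: complex_inner) \<Rightarrow> bool" where
  "weakly_polynomial P \<longleftrightarrow>
     (\<forall>z. clinear (P z)) \<and> (\<forall>x y. polyfun (\<lambda>z. cinner (P z x) y))"

lemma weakly_polynomialD:
  assumes "weakly_polynomial P"
  shows "clinear (P z)" "polyfun (\<lambda>z. cinner (P z x) y)"
  using assms by (simp_all add: weakly_polynomial_def)

lemma weakly_polynomial_sum:
  "weakly_polynomial (\<lambda>z x. \<Sum>e\<in>E. \<Sum>f\<in>F. (cinner x e * poly (p e f) z) *\<^sub>C f)"
  unfolding weakly_polynomial_def
proof (intro conjI allI)
  show "clinear (\<lambda>x. \<Sum>e\<in>E. \<Sum>f\<in>F. (cinner x e * poly (p e f) z) *\<^sub>C f)" for z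
    by (rule clinearI)
      (simp_all add: cinner_add_left cinner_scaleC_left distrib_right scaleC_add_left sum.distrib
        scaleC_sum_right scaleC_scaleC mult.assoc)
  show "polyfun (\<lambda>z. cinner (\<Sum>e\<in>E. \<Sum>f\<in>F. (cinner x e * poly (p e f) z) *\<^sub>C f) y)" for x y
    unfolding cinner_sum_left cinner_scaleC_left by (intro polyfun_intros)
qed

lemma weakly_polynomial_entries:
  assumes "parseval E" "parseval F" "weakly_polynomial P"
  shows "\<exists>p. (\<forall>z e f. cinner (P z e) f = poly (p e f) z) \<and>
    (\<forall>z x. P z x = (\<Sum>e\<in>E. \<Sum>f\<in>F. (cinner x e * poly (p e f) z) *\<^sub>C f))"
proof -
  have "\<forall>e f. \<exists>p. \<forall>z. cinner (P z e) f = poly p z"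
    using weakly_polynomialD(2)[OF assms(3)] by (simp add: polyfun_def)
  then obtain p where p: "\<And>z e f. cinner (P z e) f = poly (p e f) z"
    by metis
  have "P z x = (\<Sum>e\<in>E. \<Sum>f\<in>F. (cinner x e * poly (p e f) z) *\<^sub>C f)" for z x
  proof -
    have "P z x = (\<Sum>e\<in>E. cinner x e *\<^sub>C P z e)"
      by (rule clinear_parseval_expand[OF assms(1) weakly_polynomialD(1)[OF assms(3)]])
    also have "\<dots> = (\<Sum>e\<in>E. cinner x e *\<^sub>C (\<Sum>f\<in>F. cinner (P z e) f *\<^sub>C f))"
      by (simp only: parsevalD(2)[OF assms(2)])
    finally show ?thesis
      by (simp add: p scaleC_sum_right scaleC_scaleC)
  qed
  with p show ?thesis by blast
qed

lemma operator_polynomial_if_weakly_polynomial: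
  fixes P :: "complex \<Rightarrow> 'a :: complex_inner \<Rightarrow> 'b :: complex_inner"
  assumes "finite_dimensional TYPE('a)" "finite_dimensional TYPE('b)" "weakly_polynomial P"
  shows "operator_polynomial P"
proof -
  obtain E :: "'a set" where E: "parseval E"
    using finite_dimensional_parseval[OF assms(1)] .
  obtain F :: "'b set" where F: "parseval F"
    using finite_dimensional_parseval[OF assms(2)] .
  obtain p where p: "\<And>z x. P z x = (\<Sum>e\<in>E. \<Sum>f\<in>F. (cinner x e * poly (p e f) z) *\<^sub>C f)"
    using weakly_polynomial_entries[OF E F assms(3)] by blast
  define T where "T k x = (\<Sum>e\<in>E. \<Sum>f\<in>F. (cinner x e * coeff (p e f) k) *\<^sub>C f)" for k x
  define n where "n = (\<Sum>e\<in>E. \<Sum>f\<in>F. degree (p e f))"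
  have "clinear (T k)" for k
    using weakly_polynomialD(1)[OF weakly_polynomial_sum[where E = E and F = F
        and p = "\<lambda>e f. [:coeff (p e f) k:]"], of 0]
    by (simp add: T_def[abs_def])
  then have "bounded_operator (T k)" for k
    by (rule bounded_operator_if_clinear[OF assms(1)])
  moreover have "P z x = (\<Sum>k\<le>n. z ^ k *\<^sub>C T k x)" for z x
  proof -
    have pz: "poly (p e f) z = (\<Sum>k\<le>n. coeff (p e f) k * z ^ k)" if "e \<in> E" "f \<in> F" for e f
    proof -
      have "degree (p e f) \<le> (\<Sum>f\<in>F. degree (p e f))"
        using that parsevalD(1)[OF F] by (intro member_le_sum) auto
      also have "\<dots> \<le> n"
        unfolding n_def using that parsevalD(1)[OF E]
        by (intro member_le_sum[of e E "\<lambda>e. \<Sum>f\<in>F. degree (p e f)"]) auto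
      finally show ?thesis
        unfolding poly_altdef by (intro sum.mono_neutral_left) (auto simp: coeff_eq_0)
    qed
    have "P z x = (\<Sum>e\<in>E. \<Sum>f\<in>F. \<Sum>k\<le>n. z ^ k *\<^sub>C (cinner x e * coeff (p e f) k) *\<^sub>C f)"
      unfolding p
      by (intro sum.cong refl) (simp add: pz sum_distrib_left scaleC_sum_left scaleC_scaleC mult_ac)
    also have "\<dots> = (\<Sum>e\<in>E. \<Sum>k\<le>n. \<Sum>f\<in>F. z ^ k *\<^sub>C (cinner x e * coeff (p e f) k) *\<^sub>C f)"
      by (intro sum.cong refl sum.swap)
    also have "\<dots> = (\<Sum>k\<le>n. z ^ k *\<^sub>C T k x)"
      unfolding T_def scaleC_sum_right by (rule sum.swap)
    finally show ?thesis .
  qed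
  ultimately show ?thesis
    unfolding operator_polynomial_def by blast
qed

lemma weakly_polynomial_if_operator_polynomial:
  assumes "operator_polynomial P"
  shows "weakly_polynomial P"
proof -
  from assms obtain n T where T: "\<And>k. bounded_operator (T k)"
    and P: "P = (\<lambda>z x. \<Sum>k\<le>n. z ^ k *\<^sub>C T k x)"
    unfolding operator_polynomial_def by blast
  have lin: "clinear (T k)" for k
    using T by (simp add: bounded_operator_def)
  show ?thesis
    unfolding weakly_polynomial_def P
  proof (intro conjI allI)
    show "clinear (\<lambda>x. \<Sum>k\<le>n. z ^ k *\<^sub>C T k x)" for z
      by (rule clinearI)
        (simp_all add: clinear_add[OF lin] clinear_scaleC[OF lin] scaleC_add_right sum.distrib
          scaleC_sum_right scaleC_scaleC mult.commute)
    show "polyfun (\<lambda>z. cinner (\<Sum>k\<le>n. z ^ k *\<^sub>C T k x) y)" for x y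
      unfolding cinner_sum_left cinner_scaleC_left by (intro polyfun_intros)
  qed
qed

lemma weakly_polynomial_divide:
  fixes P :: "complex \<Rightarrow> 'a :: complex_inner \<Rightarrow> 'b :: complex_inner"
  assumes "finite_dimensional TYPE('a)" "finite_dimensional TYPE('b)"
    and "weakly_polynomial P" "\<And>x. P z0 x = 0"
  obtains P' where "weakly_polynomial P'" "\<And>z x. P z x = (z - z0) *\<^sub>C P' z x"
proof -
  obtain E :: "'a set" where E: "parseval E"
    using finite_dimensional_parseval[OF assms(1)] .
  obtain F :: "'b set" where F: "parseval F"
    using finite_dimensional_parseval[OF assms(2)] .
  obtain p where p: "\<And>z e f. cinner (P z e) f = poly (p e f) z"
    "\<And>z x. P z x = (\<Sum>e\<in>E. \<Sum>f\<in>F. (cinner x e * poly (p e f) z) *\<^sub>C f)"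
    using weakly_polynomial_entries[OF E F assms(3)] by blast
  have "\<forall>e f. \<exists>g. p e f = [:- z0, 1:] * g"
    using p(1) assms(4) by (metis cinner_zero_left poly_eq_0_iff_dvd dvd_def)
  then obtain g where g: "\<And>e f. p e f = [:- z0, 1:] * g e f"
    by metis
  show ?thesis
  proof (rule that[OF weakly_polynomial_sum[where E = E and F = F and p = g]])
    show "P z x = (z - z0) *\<^sub>C (\<Sum>e\<in>E. \<Sum>f\<in>F. (cinner x e * poly (g e f) z) *\<^sub>C f)" for z x
      unfolding p(2) scaleC_sum_right
      by (intro sum.cong refl) (simp add: g scaleC_scaleC algebra_simps)
  qed
qed

text \<open>
  Repeated cancellation of linear factors of a denominator at the points of \<open>Z\<close>; \<open>\<Phi> q\<close> says that
  \<open>q\<close> is an admissible denominator.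
\<close>

lemma cancel_roots:
  fixes q :: "complex poly"
  assumes "\<Phi> q" "q \<noteq> 0"
    and step: "\<And>q z. \<Phi> q \<Longrightarrow> q \<noteq> 0 \<Longrightarrow> z \<in> Z \<Longrightarrow> poly q z = 0 \<Longrightarrow> \<exists>q'. q = [:- z, 1:] * q' \<and> \<Phi> q'"
  obtains q' where "\<Phi> q'" "q' \<noteq> 0" "\<And>z. z \<in> Z \<Longrightarrow> poly q' z \<noteq> 0"
proof -
  have "\<exists>q'. \<Phi> q' \<and> q' \<noteq> 0 \<and> (\<forall>z\<in>Z. poly q' z \<noteq> 0)"
    using assms(1,2)
  proof (induction "degree q" arbitrary: q rule: less_induct)
    case less
    show ?case
    proof (cases "\<forall>z\<in>Z. poly q z \<noteq> 0")
      case False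
      then obtain z where "z \<in> Z" "poly q z = 0" by blast
      then obtain q' where q': "q = [:- z, 1:] * q'" "\<Phi> q'"
        using step less.prems by blast
      have "q' \<noteq> 0" using q'(1) less.prems(2) by auto
      then have "degree q = degree [:- z, 1:] + degree q'"
        unfolding q'(1) by (intro degree_mult_eq) auto
      then have "degree q' < degree q" by simp
      then show ?thesis
        using less.hyps[of q'] q'(2) \<open>q' \<noteq> 0\<close> by blast
    qed (use less.prems in blast)
  qed
  then show ?thesis using that by blast
qed

section \<open>The resolvent as a rational function\<close>

lemma resolvent_vector:
  fixes D :: "'h :: complex_inner \<Rightarrow> 'h"
  assumes "finite_dimensional TYPE('h)" "clinear D"
  obtains q r where "q \<noteq> 0" "\<And>y. polyfun (\<lambda>z. cinner (r z) y)"
    and "\<And>z. r z - z *\<^sub>C D (r z) = poly q z *\<^sub>C x"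
proof -
  obtain n a where a: "\<exists>k\<le>n. a k \<noteq> 0" "(\<Sum>k\<le>n. a k *\<^sub>C (D ^^ k) x) = 0"
    using iterates_linear_relation[OF assms(1)] .
  \<comment> \<open>\<open>q\<close> reverses the annihilating polynomial; the geometric sum inverts \<open>I - z D\<close> up to \<open>z\<^sup>k D\<^sup>k\<close>\<close>
  define q where "q = (\<Sum>k\<le>n. monom (a k) (n - k))"
  define s where "s k z = (\<Sum>j<k. z ^ j *\<^sub>C (D ^^ j) x)" for k z
  define r where "r z = (\<Sum>k\<le>n. (a k * z ^ (n - k)) *\<^sub>C s k z)" for z
  have s: "s k z - z *\<^sub>C D (s k z) = x - z ^ k *\<^sub>C (D ^^ k) x" for k z
  proof -
    have "s k z - z *\<^sub>C D (s k z)
        = (\<Sum>j<k. z ^ j *\<^sub>C (D ^^ j) x - z ^ Suc j *\<^sub>C (D ^^ Suc j) x)"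
      by (simp add: s_def clinear_sum[OF assms(2)] clinear_scaleC[OF assms(2)] scaleC_sum_right
          scaleC_scaleC sum_subtractf)
    also have "\<dots> = z ^ 0 *\<^sub>C (D ^^ 0) x - z ^ k *\<^sub>C (D ^^ k) x"
      by (rule sum_lessThan_telescope')
    finally show ?thesis by (simp add: scaleC_one)
  qed
  have qz: "poly q z = (\<Sum>k\<le>n. a k * z ^ (n - k))" for z
    by (simp add: q_def poly_sum poly_monom)
  show ?thesis
  proof (rule that[of q r])
    from a(1) obtain k where k: "k \<le> n" "a k \<noteq> 0" by blast
    have "coeff q (n - k) = (\<Sum>j\<le>n. if j = k then a k else 0)"
      unfolding q_def coeff_sum using k(1) by (intro sum.cong) auto
    then show "q \<noteq> 0" using k by auto
    show "polyfun (\<lambda>z. cinner (r z) y)" for y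
      unfolding r_def s_def cinner_sum_left cinner_scaleC_left by (intro polyfun_intros)
    show "r z - z *\<^sub>C D (r z) = poly q z *\<^sub>C x" for z
    proof -
      have "r z - z *\<^sub>C D (r z)
          = (\<Sum>k\<le>n. (a k * z ^ (n - k)) *\<^sub>C (s k z - z *\<^sub>C D (s k z)))"
        by (simp add: r_def clinear_sum[OF assms(2)] clinear_scaleC[OF assms(2)] scaleC_sum_right
            scaleC_scaleC sum_subtractf scaleC_diff_right mult_ac)
      also have "\<dots> = (\<Sum>k\<le>n. (a k * z ^ (n - k)) *\<^sub>C x - z ^ n *\<^sub>C a k *\<^sub>C (D ^^ k) x)"
      proof (intro sum.cong refl)
        fix k assume "k \<in> {..n}"
        then have "z ^ (n - k) * z ^ k = z ^ n"
          by (simp flip: power_add)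
        then have "a k * z ^ (n - k) * z ^ k = z ^ n * a k"
          by (metis mult.assoc mult.commute)
        then show "(a k * z ^ (n - k)) *\<^sub>C (s k z - z *\<^sub>C D (s k z))
            = (a k * z ^ (n - k)) *\<^sub>C x - z ^ n *\<^sub>C a k *\<^sub>C (D ^^ k) x"
          by (simp only: s scaleC_diff_right scaleC_scaleC)
      qed
      also have "\<dots> = poly q z *\<^sub>C x - z ^ n *\<^sub>C (\<Sum>k\<le>n. a k *\<^sub>C (D ^^ k) x)"
        by (simp add: sum_subtractf qz scaleC_sum_left scaleC_sum_right)
      finally show ?thesis by (simp add: a(2))
    qed
  qed
qed

text \<open>
  The relation \<open>(I - z D) R(z) = q(z) I\<close>, that is, \<open>R / q\<close> is the resolvent \<open>(I - z D)\<^sup>-\<^sup>1\<close>. It is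
  required at all \<open>z\<close>, the zeros of \<open>q\<close> included.
\<close>

definition resolvent_pair ::
    "('h :: complex_inner \<Rightarrow> 'h) \<Rightarrow> (complex \<Rightarrow> 'h \<Rightarrow> 'h) \<Rightarrow> complex poly \<Rightarrow> bool" where
  "resolvent_pair D R q \<longleftrightarrow>
     weakly_polynomial R \<and> (\<forall>z x. R z x - z *\<^sub>C D (R z x) = poly q z *\<^sub>C x)"

lemma resolvent_pair_exists:
  fixes D :: "'h :: complex_inner \<Rightarrow> 'h"
  assumes "finite_dimensional TYPE('h)" "clinear D"
  obtains R q where "resolvent_pair D R q" "q \<noteq> 0"
proof -
  obtain E :: "'h set" where E: "parseval E"
    using finite_dimensional_parseval[OF assms(1)] .
  have "\<forall>e. \<exists>q r. q \<noteq> 0 \<and> (\<forall>y. polyfun (\<lambda>z. cinner (r z) y)) \<and>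
      (\<forall>z. r z - z *\<^sub>C D (r z) = poly q z *\<^sub>C e)"
    using resolvent_vector[OF assms] by metis
  then obtain q r where q: "\<And>e. q e \<noteq> 0"
    and r: "\<And>e y. polyfun (\<lambda>z. cinner (r e z) y)"
      "\<And>e z. r e z - z *\<^sub>C D (r e z) = poly (q e) z *\<^sub>C e"
    by metis
  \<comment> \<open>common denominator: \<open>Q' e\<close> is the cofactor of \<open>q e\<close> in \<open>Q\<close>\<close>
  define Q where "Q = (\<Prod>e\<in>E. q e)"
  define Q' where "Q' e = (\<Prod>d\<in>E - {e}. q d)" for e
  define R where "R z x = (\<Sum>e\<in>E. (cinner x e * poly (Q' e) z) *\<^sub>C r e z)" for z x
  have "clinear (R z)" for z
    unfolding R_def
    by (rule clinearI)
      (simp_all add: cinner_add_left cinner_scaleC_left distrib_right scaleC_add_left sum.distrib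
        scaleC_sum_right scaleC_scaleC mult.assoc)
  moreover have "polyfun (\<lambda>z. cinner (R z x) y)" for x y
    unfolding R_def cinner_sum_left cinner_scaleC_left by (intro polyfun_intros r)
  moreover have "R z x - z *\<^sub>C D (R z x) = poly Q z *\<^sub>C x" for z x
  proof -
    have "R z x - z *\<^sub>C D (R z x)
        = (\<Sum>e\<in>E. (cinner x e * poly (Q' e) z) *\<^sub>C (r e z - z *\<^sub>C D (r e z)))"
      by (simp add: R_def clinear_sum[OF assms(2)] clinear_scaleC[OF assms(2)] scaleC_sum_right
          scaleC_scaleC sum_subtractf scaleC_diff_right mult_ac)
    also have "\<dots> = (\<Sum>e\<in>E. poly Q z *\<^sub>C cinner x e *\<^sub>C e)"
    proof (intro sum.cong refl)
      fix e assume "e \<in> E"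
      then have "Q = q e * Q' e"
        unfolding Q_def Q'_def by (rule prod.remove[OF parsevalD(1)[OF E]])
      then show "(cinner x e * poly (Q' e) z) *\<^sub>C (r e z - z *\<^sub>C D (r e z))
          = poly Q z *\<^sub>C cinner x e *\<^sub>C e"
        by (simp add: r(2) scaleC_scaleC mult_ac)
    qed
    also have "\<dots> = poly Q z *\<^sub>C x"
      by (simp add: parsevalD(2)[OF E] flip: scaleC_sum_right)
    finally show ?thesis .
  qed
  ultimately have "resolvent_pair D R Q"
    by (simp add: resolvent_pair_def weakly_polynomial_def)
  moreover have "Q \<noteq> 0"
    using q parsevalD(1)[OF E] by (simp add: Q_def)
  ultimately show ?thesis using that by blast
qed

text \<open>
  A zero \<open>z0\<close> of \<open>q\<close> at which \<open>I - z0 D\<close> is injective is a zero of \<open>R\<close> as well, so the common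
  factor \<open>z - z0\<close> cancels.
\<close>

lemma resolvent_pair_reduced:
  fixes D :: "'h :: complex_inner \<Rightarrow> 'h"
  assumes "finite_dimensional TYPE('h)" "clinear D"
  obtains R q where "resolvent_pair D R q" "q \<noteq> 0"
    and "\<And>z. inj (\<lambda>h. h - z *\<^sub>C D h) \<Longrightarrow> poly q z \<noteq> 0"
proof -
  obtain R0 q0 where 0: "resolvent_pair D R0 q0" "q0 \<noteq> 0"
    using resolvent_pair_exists[OF assms] .
  let ?Z = "{z. inj (\<lambda>h. h - z *\<^sub>C D h)}"
  have step: "\<exists>q'. q = [:- z0, 1:] * q' \<and> (\<exists>R. resolvent_pair D R q')"
    if "\<exists>R. resolvent_pair D R q" "q \<noteq> 0" "z0 \<in> ?Z" and root: "poly q z0 = 0" for q z0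
  proof -
    from that obtain R where R: "weakly_polynomial R"
      "\<And>z x. R z x - z *\<^sub>C D (R z x) = poly q z *\<^sub>C x"
      by (auto simp: resolvent_pair_def)
    from root obtain q' where q': "q = [:- z0, 1:] * q'"
      by (auto simp: poly_eq_0_iff_dvd dvd_def)
    have "R z0 x = 0" for x
    proof -
      have "R z0 x - z0 *\<^sub>C D (R z0 x) = 0 - z0 *\<^sub>C D 0"
        using R(2)[of z0 x] root by (simp add: clinear_zero[OF assms(2)])
      with \<open>z0 \<in> ?Z\<close> show ?thesis
        unfolding mem_Collect_eq by (rule injD[where y = 0])
    qed
    then obtain R' where R': "weakly_polynomial R'" "\<And>z x. R z x = (z - z0) *\<^sub>C R' z x"
      using weakly_polynomial_divide[OF assms(1) assms(1) R(1)] by metis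
    have "R' z x - z *\<^sub>C D (R' z x) = poly q' z *\<^sub>C x" for z x
    proof (rule cinner_ext)
      fix y
      let ?f = "\<lambda>z. cinner (R' z x - z *\<^sub>C D (R' z x) - poly q' z *\<^sub>C x) y"
      have poly: "polyfun ?f"
        unfolding cinner_diff_left cinner_scaleC_left cinner_cadjoint[OF assms]
        by (intro polyfun_intros weakly_polynomialD(2)[OF R'(1)])
      have "(w - z0) * ?f w = 0" for w
      proof -
        have "(w - z0) *\<^sub>C (R' w x - w *\<^sub>C D (R' w x) - poly q' w *\<^sub>C x)
            = R w x - w *\<^sub>C D (R w x) - poly q w *\<^sub>C x"
          by (simp add: R'(2) q' scaleC_diff_right scaleC_scaleC clinear_scaleC[OF assms(2)])
            (simp add: algebra_simps)
        also have "\<dots> = 0" by (simp add: R(2))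
        finally show ?thesis
          by (metis cinner_scaleC_left cinner_zero_left)
      qed
      then have "?f z = 0"
        using polyfun_cancel[OF poly] by blast
      then show "cinner (R' z x - z *\<^sub>C D (R' z x)) y = cinner (poly q' z *\<^sub>C x) y"
        by (simp add: cinner_diff_left)
    qed
    then show ?thesis
      using q' R'(1) unfolding resolvent_pair_def by blast
  qed
  obtain q where "\<exists>R. resolvent_pair D R q" "q \<noteq> 0" "\<And>z. z \<in> ?Z \<Longrightarrow> poly q z \<noteq> 0"
    by (rule cancel_roots[of "\<lambda>q. \<exists>R. resolvent_pair D R q" q0 ?Z]) (use 0 step in blast)+
  then show ?thesis using that by blast
qed


section \<open>Characteristic functions of isometric colligations\<close>

lemma clinear_blocks:
  assumes "clinear U"
  shows "clinear (blockA U)" "clinear (blockB U)" "clinear (blockC U)" "clinear (blockD U)"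
proof -
  have "U (x + y, 0) = U (x, 0) + U (y, 0)" "U (0, h + k) = U (0, h) + U (0, k)" for x y h k
    by (simp_all flip: clinear_add[OF assms])
  moreover have "U (c *\<^sub>C x, 0) = c *\<^sub>C U (x, 0)" "U (0, c *\<^sub>C h) = c *\<^sub>C U (0, h)" for c x h
    using clinear_scaleC[OF assms, of c "(x, 0)"] clinear_scaleC[OF assms, of c "(0, h)"]
    by (simp_all add: scaleC_prod_def)
  ultimately show "clinear (blockA U)" "clinear (blockB U)" "clinear (blockC U)" "clinear (blockD U)"
    by (auto intro!: clinearI simp: blockA_def blockB_def blockC_def blockD_def scaleC_prod_def)
qed

lemma clinear_pencil: "clinear D \<Longrightarrow> clinear (\<lambda>h. h - z *\<^sub>C D h)"
  by (rule clinearI)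
    (simp_all add: clinear_add clinear_scaleC scaleC_add_right scaleC_diff_right scaleC_scaleC
      mult.commute)

lemma characteristic_function_eq_Some_iff:
  fixes U :: "'e :: chilbert_space \<times> 'h :: chilbert_space \<Rightarrow> 'f :: chilbert_space \<times> 'h"
  assumes "finite_dimensional TYPE('h)" "clinear U"
  shows "characteristic_function U z = Some S \<longleftrightarrow>
    inj (\<lambda>h. h - z *\<^sub>C blockD U h) \<and>
    S = (\<lambda>x. blockA U x + z *\<^sub>C blockB U (inv (\<lambda>h. h - z *\<^sub>C blockD U h) (blockC U x)))"
  using invertible_operator_iff_inj[OF assms(1) clinear_pencil[OF clinear_blocks(4)[OF assms(2)]], of z]
  by (auto simp: characteristic_function_def)

text \<open>
  The state \<open>k = (I - z D)\<^sup>-\<^sup>1 C x\<close> satisfies \<open>U (x, z k) = (S(z) x, k)\<close>. For isometric \<open>U\<close>, comparing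
  norms gives \<open>\<parallel>S(z) x\<parallel>\<^sup>2 = \<parallel>x\<parallel>\<^sup>2 - (1 - \<bar>z\<bar>\<^sup>2) \<parallel>k\<parallel>\<^sup>2\<close>.
\<close>

lemma characteristic_function_state:
  fixes U :: "'e :: chilbert_space \<times> 'h :: chilbert_space \<Rightarrow> 'f :: chilbert_space \<times> 'h"
  assumes "finite_dimensional TYPE('h)" "clinear U" "characteristic_function U z = Some S"
  obtains k where "U (x, z *\<^sub>C k) = (S x, k)"
proof -
  let ?T = "\<lambda>h. h - z *\<^sub>C blockD U h"
  have inj: "inj ?T" and S: "S x = blockA U x + z *\<^sub>C blockB U (inv ?T (blockC U x))"
    using assms(3) unfolding characteristic_function_eq_Some_iff[OF assms(1,2)] by auto
  have surj: "surj ?T"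
    using assms(1) clinear_pencil[OF clinear_blocks(4)[OF assms(2)]] inj by (rule clinear_inj_imp_surj)
  define k where "k = inv ?T (blockC U x)"
  have k: "k - z *\<^sub>C blockD U k = blockC U x"
    unfolding k_def by (rule surj_f_inv_f[OF surj])
  have "U (x, z *\<^sub>C k) = U ((x, 0) + z *\<^sub>C (0, k))"
    by (simp add: scaleC_prod_def)
  also have "\<dots> = (blockA U x, blockC U x) + z *\<^sub>C (blockB U k, blockD U k)"
    by (simp add: clinear_add[OF assms(2)] clinear_scaleC[OF assms(2)]
        blockA_def blockB_def blockC_def blockD_def)
  also have "\<dots> = (S x, k)"
    using k by (simp add: scaleC_prod_def S k_def[symmetric] algebra_simps)
  finally show ?thesis using that by blast
qed

lemma characteristic_function_norm:
  fixes U :: "'e :: chilbert_space \<times> 'h :: chilbert_space \<Rightarrow> 'f :: chilbert_space \<times> 'h"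
  assumes "finite_dimensional TYPE('h)" "clinear U" "\<And>w. norm (U w) = norm w"
    and "characteristic_function U z = Some S"
  shows "norm z \<le> 1 \<Longrightarrow> norm (S x) \<le> norm x" and "norm z = 1 \<Longrightarrow> norm (S x) = norm x"
proof -
  obtain k where "U (x, z *\<^sub>C k) = (S x, k)"
    using characteristic_function_state[OF assms(1,2,4)] .
  then have "norm (S x, k) = norm (x, z *\<^sub>C k)"
    by (metis assms(3))
  then have eq: "(norm (S x))\<^sup>2 + (norm k)\<^sup>2 = (norm x)\<^sup>2 + (norm z)\<^sup>2 * (norm k)\<^sup>2"
    by (simp add: norm_Pair norm_scaleC power_mult_distrib)
  show "norm (S x) \<le> norm x" if "norm z \<le> 1"
  proof -
    have "(norm z)\<^sup>2 * (norm k)\<^sup>2 \<le> 1 * (norm k)\<^sup>2"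
      using that by (intro mult_right_mono) (auto simp: power_le_one)
    with eq have "(norm (S x))\<^sup>2 \<le> (norm x)\<^sup>2" by linarith
    then show ?thesis by (rule power2_le_imp_le) simp
  qed
  show "norm (S x) = norm x" if "norm z = 1"
    using eq that by simp
qed

lemma characteristic_function_defined:
  fixes U :: "'e :: chilbert_space \<times> 'h :: chilbert_space \<Rightarrow> 'f :: chilbert_space \<times> 'h"
  assumes "finite_dimensional TYPE('h)" "clinear U" "\<And>w. norm (U w) = norm w" "norm z < 1"
  obtains S where "characteristic_function U z = Some S"
proof -
  have "h = 0" if "h - z *\<^sub>C blockD U h = 0" for h
  proof (rule ccontr)
    assume "h \<noteq> 0"
    have "norm (blockD U h) \<le> norm (U (0, h))"
      unfolding blockD_def by (metis norm_snd_le prod.collapse)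
    also have "\<dots> = norm h"
      by (simp add: assms(3) norm_Pair)
    finally have "norm z * norm (blockD U h) \<le> norm z * norm h"
      by (intro mult_left_mono) auto
    also have "\<dots> < norm h"
      using assms(4) \<open>h \<noteq> 0\<close> by simp
    finally have "norm (z *\<^sub>C blockD U h) < norm h"
      by (simp add: norm_scaleC)
    then show False using that by simp
  qed
  then have "inj (\<lambda>h. h - z *\<^sub>C blockD U h)"
    by (simp add: clinear_inj_iff[OF clinear_pencil[OF clinear_blocks(4)[OF assms(2)]]])
  then show ?thesis
    using that characteristic_function_eq_Some_iff[OF assms(1,2)] by blast
qed

lemma rational_representation_characteristic_function:
  fixes U :: "'e :: chilbert_space \<times> 'h :: chilbert_space \<Rightarrow> 'f :: chilbert_space \<times> 'h"
  assumes fd: "finite_dimensional TYPE('e)" "finite_dimensional TYPE('f)" "finite_dimensional TYPE('h)"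
    and U: "clinear U"
  obtains P q where "rational_representation (characteristic_function U) P q"
proof -
  note blocks = clinear_blocks[OF U]
  obtain R q where RD: "resolvent_pair (blockD U) R q" and "q \<noteq> 0"
    and q: "\<And>z. inj (\<lambda>h. h - z *\<^sub>C blockD U h) \<Longrightarrow> poly q z \<noteq> 0"
    using resolvent_pair_reduced[OF fd(3) blocks(4)] by blast
  from RD have R: "weakly_polynomial R"
    "\<And>z x. R z x - z *\<^sub>C blockD U (R z x) = poly q z *\<^sub>C x"
    by (auto simp: resolvent_pair_def)
  note linR = weakly_polynomialD(1)[OF R(1)]
  define P where "P z x = poly q z *\<^sub>C blockA U x + z *\<^sub>C blockB U (R z (blockC U x))" for z x
  have "characteristic_function U z \<noteq> None" if nz: "poly q z \<noteq> 0" for z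
  proof -
    have "surj (\<lambda>h. h - z *\<^sub>C blockD U h)"
    proof (rule surjI)
      show "R z (inverse (poly q z) *\<^sub>C h) - z *\<^sub>C blockD U (R z (inverse (poly q z) *\<^sub>C h)) = h"
        for h
        by (simp add: R(2) scaleC_inverse_cancel[OF nz])
    qed
    with fd(3) clinear_pencil[OF blocks(4)] have "inj (\<lambda>h. h - z *\<^sub>C blockD U h)"
      by (rule clinear_surj_imp_inj)
    then show ?thesis
      using characteristic_function_eq_Some_iff[OF fd(3) U, of z] by simp
  qed
  then have "{z. characteristic_function U z = None} \<subseteq> {z. poly q z = 0}"
    by blast
  then have "finite {z. characteristic_function U z = None}"
    using poly_roots_finite[OF \<open>q \<noteq> 0\<close>] by (rule finite_subset)
  moreover have "weakly_polynomial P"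
    unfolding weakly_polynomial_def
  proof (intro conjI allI)
    show "clinear (P z)" for z
      unfolding P_def
      by (rule clinearI)
        (simp_all add: clinear_add[OF blocks(1)] clinear_add[OF blocks(2)] clinear_add[OF blocks(3)]
          clinear_add[OF linR] clinear_scaleC[OF blocks(1)] clinear_scaleC[OF blocks(2)]
          clinear_scaleC[OF blocks(3)] clinear_scaleC[OF linR] scaleC_add_right scaleC_scaleC
          mult.commute)
    show "polyfun (\<lambda>z. cinner (P z x) y)" for x y
      unfolding P_def cinner_add_left cinner_scaleC_left cinner_cadjoint[OF fd(3) blocks(2)]
      by (intro polyfun_intros weakly_polynomialD(2)[OF R(1)])
  qed
  then have "operator_polynomial P"
    by (rule operator_polynomial_if_weakly_polynomial[OF fd(1,2)])
  moreover have "poly q z \<noteq> 0 \<and> S = (\<lambda>x. inverse (poly q z) *\<^sub>C P z x)"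
    if "characteristic_function U z = Some S" for z S
  proof -
    let ?T = "\<lambda>h. h - z *\<^sub>C blockD U h"
    have inj: "inj ?T" and S: "S = (\<lambda>x. blockA U x + z *\<^sub>C blockB U (inv ?T (blockC U x)))"
      using that unfolding characteristic_function_eq_Some_iff[OF fd(3) U] by auto
    have q0: "poly q z \<noteq> 0" using q[OF inj] .
    have "inv ?T y = inverse (poly q z) *\<^sub>C R z y" for y
    proof (rule inv_f_eq[OF inj])
      have "?T (inverse (poly q z) *\<^sub>C R z y) = inverse (poly q z) *\<^sub>C ?T (R z y)"
        by (rule clinear_scaleC[OF clinear_pencil[OF blocks(4)]])
      then show "?T (inverse (poly q z) *\<^sub>C R z y) = y"
        by (simp add: R(2) scaleC_inverse_cancel[OF q0])
    qed
    then show ?thesis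
      using q0 by (simp add: S P_def scaleC_add_right scaleC_one clinear_scaleC[OF blocks(2)]
          scaleC_scaleC mult.commute)
  qed
  ultimately show ?thesis
    using that[of P q] \<open>q \<noteq> 0\<close> unfolding rational_representation_def by blast
qed

text \<open>
  Singularities on the unit circle are removable: \<open>P = q S\<close> and \<open>\<parallel>S(z)\<parallel> \<le> 1\<close> in the disc force \<open>P\<close> to vanish
  wherever \<open>q\<close> does on the circle, so the common linear factor cancels.
\<close>

lemma rational_representation_closed_disc:
  fixes U :: "'e :: chilbert_space \<times> 'h :: chilbert_space \<Rightarrow> 'f :: chilbert_space \<times> 'h"
  assumes fd: "finite_dimensional TYPE('e)" "finite_dimensional TYPE('f)" "finite_dimensional TYPE('h)"
    and U: "clinear U" "\<And>w. norm (U w) = norm w"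
  obtains P q where "rational_representation (characteristic_function U) P q"
    and "\<And>z. norm z \<le> 1 \<Longrightarrow> poly q z \<noteq> 0"
proof -
  let ?S = "characteristic_function U"
  obtain P0 q0 where 0: "rational_representation ?S P0 q0"
    using rational_representation_characteristic_function[OF fd U(1)] .
  have step: "\<exists>q'. q = [:- z0, 1:] * q' \<and> (\<exists>P. rational_representation ?S P q')"
    if "\<exists>P. rational_representation ?S P q" "q \<noteq> 0" "z0 \<in> cball 0 1" and root: "poly q z0 = 0"
    for q z0
  proof -
    from that obtain P where P: "rational_representation ?S P q" by blast
    then have opP: "operator_polynomial P"
      by (simp add: rational_representation_def)
    have PS: "poly q z \<noteq> 0" "T = (\<lambda>x. inverse (poly q z) *\<^sub>C P z x)" if "?S z = Some T" for z T
      using P that unfolding rational_representation_def by blast+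
    from root obtain q' where q': "q = [:- z0, 1:] * q'"
      by (auto simp: poly_eq_0_iff_dvd dvd_def)
    have "P z0 x = 0" for x
    proof -
      let ?F = "at z0 within ball 0 1"
      have nontrivial: "?F \<noteq> bot"
        using \<open>z0 \<in> cball 0 1\<close> by (simp add: trivial_limit_within islimpt_ball)
      have limP: "((\<lambda>z. norm (P z x)) \<longlongrightarrow> norm (P z0 x)) ?F"
        using isCont_operator_polynomial[OF opP, where x = x and z = z0]
        unfolding isCont_def by (rule tendsto_norm[OF tendsto_within_subset[OF _ subset_UNIV]])
      have limq: "((\<lambda>z. norm (poly q z) * norm x) \<longlongrightarrow> norm (poly q z0) * norm x) ?F"
        using poly_isCont[of z0 q] unfolding isCont_def
        by (rule tendsto_mult_right[OF tendsto_norm[OF tendsto_within_subset[OF _ subset_UNIV]]])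
      have "norm (P z x) \<le> norm (poly q z) * norm x" if "z \<in> ball 0 1" for z
      proof -
        have z: "norm z < 1" using that by simp
        obtain T where T: "?S z = Some T"
          using characteristic_function_defined[OF fd(3) U z] .
        have "norm (inverse (poly q z) *\<^sub>C P z x) \<le> norm x"
          using characteristic_function_norm(1)[OF fd(3) U T, where x = x] z PS(2)[OF T] by simp
        then show ?thesis
          using PS(1)[OF T] by (simp add: norm_scaleC norm_divide field_simps)
      qed
      then have le: "\<forall>\<^sub>F z in ?F. norm (P z x) \<le> norm (poly q z) * norm x"
        by (auto simp: eventually_at_filter)
      have "norm (P z0 x) \<le> norm (poly q z0) * norm x"
        by (rule tendsto_le[OF nontrivial limq limP le])
      then show ?thesis using root by simp
    qed
    then obtain P' where P': "weakly_polynomial P'" "\<And>z x. P z x = (z - z0) *\<^sub>C P' z x"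
      using weakly_polynomial_divide[OF fd(1,2) weakly_polynomial_if_operator_polynomial[OF opP]]
      by metis
    have "rational_representation ?S P' q'"
      unfolding rational_representation_def
    proof (intro conjI allI impI)
      show "finite {z. ?S z = None}" using P by (simp add: rational_representation_def)
      show "operator_polynomial P'"
        by (rule operator_polynomial_if_weakly_polynomial[OF fd(1,2) P'(1)])
      show "q' \<noteq> 0" using \<open>q \<noteq> 0\<close> q' by auto
      fix z T assume T: "?S z = Some T"
      then have nz: "z - z0 \<noteq> 0" "poly q' z \<noteq> 0"
        using PS(1) q' by auto
      show "poly q' z \<noteq> 0" by fact
      have "poly q z = (z - z0) * poly q' z"
        by (simp add: q' algebra_simps)
      then have "inverse (poly q z) * (z - z0) = inverse (poly q' z)"
        using nz by simp
      then show "T = (\<lambda>x. inverse (poly q' z) *\<^sub>C P' z x)"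
        using PS(2)[OF T] by (simp add: P'(2) scaleC_scaleC)
    qed
    then show ?thesis using q' by blast
  qed
  have "q0 \<noteq> 0" using 0 by (simp add: rational_representation_def)
  obtain q where "\<exists>P. rational_representation ?S P q" "q \<noteq> 0" "\<And>z. z \<in> cball 0 1 \<Longrightarrow> poly q z \<noteq> 0"
    by (rule cancel_roots[of "\<lambda>q. \<exists>P. rational_representation ?S P q" q0 "cball 0 1"])
      (use 0 \<open>q0 \<noteq> 0\<close> step in blast)+
  then show ?thesis using that by auto
qed

section \<open>Contractions, isometries and their adjoints\<close>

lemma positive_operator_diff:
  fixes T :: "'a :: complex_inner \<Rightarrow> 'b :: complex_inner"
  assumes adj: "\<And>x y. cinner (T x) y = cinner x (T' y)" and le: "\<And>x. norm (T x) \<le> norm x"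
  shows "positive_operator (\<lambda>x. x - T' (T x))"
  unfolding positive_operator_def
proof (intro allI)
  fix x
  have "cinner (T' (T x)) x = complex_of_real ((norm (T x))\<^sup>2)"
    by (metis adj cinner_commute cinner_self)
  then have "cinner (x - T' (T x)) x = complex_of_real ((norm x)\<^sup>2 - (norm (T x))\<^sup>2)"
    by (simp add: cinner_diff_left cinner_self)
  moreover have "(norm (T x))\<^sup>2 \<le> (norm x)\<^sup>2"
    using le by (simp add: power_mono)
  ultimately show "cinner (x - T' (T x)) x \<in> \<real> \<and> 0 \<le> Re (cinner (x - T' (T x)) x)"
    by (metis Re_complex_of_real Reals_of_real diff_ge_0_iff_ge)
qed

text \<open>\<open>\<parallel>T\<^sup>* y\<parallel>\<^sup>2 = Re \<langle>T T\<^sup>* y, y\<rangle> \<le> \<parallel>T\<^sup>* y\<parallel> \<parallel>y\<parallel>\<close>.\<close>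

lemma adjoint_contraction:
  fixes T :: "'a :: complex_inner \<Rightarrow> 'b :: complex_inner"
  assumes adj: "\<And>x y. cinner (T x) y = cinner x (T' y)" and le: "\<And>x. norm (T x) \<le> norm x"
  shows "norm (T' y) \<le> norm y"
proof -
  have "(norm (T' y))\<^sup>2 = Re (cinner (T (T' y)) y)"
    by (simp add: adj cinner_self)
  also have "\<dots> \<le> norm (T (T' y)) * norm y"
    unfolding inner_eq_Re_cinner[symmetric] by (rule norm_cauchy_schwarz)
  also have "\<dots> \<le> norm (T' y) * norm y"
    by (intro mult_right_mono le) simp
  finally show ?thesis
    by (cases "T' y = 0") (simp_all add: power2_eq_square)
qed

text \<open>
  \<open>T\<^sup>* T = I\<close> for isometric \<open>T\<close>, by expanding \<open>\<parallel>T\<^sup>* T x - x\<parallel>\<^sup>2\<close>, where \<open>\<parallel>T\<^sup>* T x\<parallel> \<le> \<parallel>x\<parallel>\<close>.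
\<close>

lemma adjoint_isometry_cancel:
  fixes T :: "'a :: complex_inner \<Rightarrow> 'b :: complex_inner"
  assumes adj: "\<And>x y. cinner (T x) y = cinner x (T' y)" and iso: "\<And>x. norm (T x) = norm x"
  shows "T' (T x) = x"
proof -
  have "inner (T' (T x)) x = (norm x)\<^sup>2"
    by (metis adj cinner_self inner_commute inner_eq_Re_cinner iso Re_complex_of_real)
  moreover have "(norm (T' (T x)))\<^sup>2 \<le> (norm x)\<^sup>2"
    using adjoint_contraction[OF adj, of "T x"] iso by (simp add: power_mono)
  moreover have "(norm (T' (T x) - x))\<^sup>2 = (norm (T' (T x)))\<^sup>2 - 2 * inner (T' (T x)) x + (norm x)\<^sup>2"
    by (simp add: power2_norm_eq_inner inner_diff_left inner_diff_right inner_commute)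
  ultimately have "(norm (T' (T x) - x))\<^sup>2 \<le> 0" by linarith
  then show ?thesis by simp
qed

section \<open>Unitary colligations\<close>

lemma islimpt_unit_circle:
  fixes t :: complex
  assumes "norm t = 1"
  shows "t islimpt sphere 0 1"
proof (rule connected_imp_perfect)
  show "connected (sphere (0 :: complex) 1)"
    by (rule connected_sphere) simp
  have "1 \<in> sphere (0 :: complex) 1" "-1 \<in> sphere (0 :: complex) 1" "(1 :: complex) \<noteq> -1"
    by simp_all
  then show "sphere (0 :: complex) 1 \<noteq> {a}" for a
    by (metis singletonD)
qed (use assms in simp)

lemma infinite_unit_circle: "infinite (sphere (0 :: complex) 1)"
  using islimpt_finite islimpt_unit_circle[of 1] by fastforce

theorem theorem3p5:
  fixes U :: "'e :: chilbert_space \<times> 'h :: chilbert_space \<Rightarrow> 'f :: chilbert_space \<times> 'h"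
  assumes "operator_colligation U"
    and "finite_dimensional_colligation U"
    and "unitary_colligation U"
  shows "rational_inner_function (characteristic_function U)"
proof -
  let ?S = "characteristic_function U"
  have U: "clinear U"
    using assms(1) by (simp add: operator_colligation_def bounded_operator_def)
  have fd: "finite_dimensional TYPE('e)" "finite_dimensional TYPE('f)" "finite_dimensional TYPE('h)"
    using assms(2) by (simp_all add: finite_dimensional_colligation_def)
  note fd_prod = finite_dimensional_prod[OF fd(1,3)]
  have inverse: "cadjoint U (U w) = w" "U (cadjoint U w') = w'" for w w'
    using assms(3) unfolding unitary_colligation_def by (metis comp_apply id_apply)+
  have iso: "norm (U w) = norm w" for w
  proof -
    have "cinner (U w) (U w) = cinner w w"
      by (simp add: cinner_cadjoint[OF fd_prod U] inverse)
    then have "(norm (U w))\<^sup>2 = (norm w)\<^sup>2"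
      unfolding cinner_self using of_real_eq_iff by blast
    then show ?thesis by simp
  qed
  have iso': "norm (cadjoint U w) = norm w" for w
    by (metis iso inverse(2))
  have U': "clinear (cadjoint U)"
    by (rule clinear_cadjoint[OF fd_prod U])

  obtain P q where rep: "rational_representation ?S P q" and q: "\<And>z. norm z \<le> 1 \<Longrightarrow> poly q z \<noteq> 0"
    using rational_representation_closed_disc[OF fd U iso] by blast
  have opP: "operator_polynomial P" and fin: "finite {z. ?S z = None}"
    using rep by (simp_all add: rational_representation_def)
  define V where "V z = (\<lambda>x. inverse (poly q z) *\<^sub>C P z x)" for z
  have val: "rational_value ?S z = V z" if "norm z \<le> 1" for z
    unfolding V_def by (rule rational_value_eq[OF rep q[OF that]])
  have VS: "V z = T" if "?S z = Some T" for z T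
    using rep that unfolding rational_representation_def V_def by blast
  have linV: "clinear (V z)" for z
    using weakly_polynomialD(1)[OF weakly_polynomial_if_operator_polynomial[OF opP], of z]
    unfolding V_def
    by (intro clinearI)
      (simp_all add: clinear_add clinear_scaleC scaleC_add_right scaleC_scaleC mult.commute)
  note adj = cinner_cadjoint[OF fd(1) linV]

  have disc: "norm (V z x) \<le> norm x" if z: "norm z < 1" for z x
  proof -
    obtain T where "?S z = Some T"
      using characteristic_function_defined[OF fd(3) U iso z] .
    then show ?thesis
      using characteristic_function_norm(1)[OF fd(3) U iso, where z = z and S = T and x = x]
            VS z by simp
  qed
  have circle: "norm (V t x) = norm x" if t: "norm t = 1" for t x
  proof -
    \<comment> \<open>the norm identity holds off a finite subset of the circle and extends by continuity\<close>
    let ?F = "at t within sphere 0 1"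
    have "?F \<noteq> bot"
      using islimpt_unit_circle[OF t] by (simp add: trivial_limit_within)
    moreover have "isCont (\<lambda>z. V z x) t"
      unfolding V_def using q[of t] t
      by (intro continuous_scaleC continuous_at_within_inverse isCont_operator_polynomial[OF opP])
        auto
    then have "((\<lambda>z. norm (V z x)) \<longlongrightarrow> norm (V t x)) ?F"
      unfolding isCont_def by (rule tendsto_norm[OF tendsto_within_subset[OF _ subset_UNIV]])
    moreover have "\<forall>\<^sub>F z in ?F. norm (V z x) = norm x"
    proof -
      have "\<forall>\<^sub>F z in at t. z \<notin> {z. ?S z = None}"
        using islimpt_finite[OF fin] islimpt_iff_eventually by blast
      then have "\<forall>\<^sub>F z in ?F. z \<notin> {z. ?S z = None}"
        by (rule filter_leD[OF at_le[OF subset_UNIV]])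
      moreover have "\<forall>\<^sub>F z in ?F. z \<in> sphere 0 1"
        by (simp add: eventually_at_filter)
      ultimately show ?thesis
      proof eventually_elim
        case (elim z)
        then obtain T where "?S z = Some T" "norm z = 1" by auto
        then show ?case
          using characteristic_function_norm(2)[OF fd(3) U iso, where z = z and S = T and x = x]
            VS by simp
      qed
    qed
    then have "((\<lambda>z. norm (V z x)) \<longlongrightarrow> norm x) ?F"
      by (rule tendsto_eventually)
    ultimately show ?thesis by (rule tendsto_unique)
  qed

  \<comment> \<open>\<open>J\<close> is a value, on the circle, of the characteristic function of the adjoint colligation\<close>
  obtain J :: "'f \<Rightarrow> 'e" where J: "clinear J" "inj J"
  proof -
    let ?S' = "characteristic_function (cadjoint U)"
    obtain P' q' where rep': "rational_representation ?S' P' q'"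
      using rational_representation_characteristic_function[OF fd(2,1,3) U'] .
    then have "\<not> sphere 0 1 \<subseteq> {z. ?S' z = None}"
      using infinite_unit_circle finite_subset unfolding rational_representation_def by blast
    then obtain t where "t \<in> sphere 0 1" "?S' t \<noteq> None" by blast
    then obtain J where t: "norm t = 1" "?S' t = Some J" by auto
    have "clinear (P' t)"
      using rep' weakly_polynomialD(1)[OF weakly_polynomial_if_operator_polynomial]
      unfolding rational_representation_def by blast
    moreover have "J = (\<lambda>x. inverse (poly q' t) *\<^sub>C P' t x)"
      using rep' t unfolding rational_representation_def by blast
    ultimately have "clinear J"
      by (auto intro!: clinearI
          simp: clinear_add clinear_scaleC scaleC_add_right scaleC_scaleC mult.commute)
    moreover from this have "inj J"
      using characteristic_function_norm(2)[OF fd(3) U' iso' t(2,1)]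
      by (simp add: clinear_inj_iff) (metis norm_eq_zero)
    ultimately show ?thesis using that by blast
  qed
  have surj: "surj (V t)" if t: "norm t = 1" for t
  proof -
    have "inj (V t)"
      using circle[OF t] by (simp add: clinear_inj_iff[OF linV]) (metis norm_eq_zero)
    then have "inj (J \<circ> V t)" using J(2) by (rule inj_compose[rotated])
    moreover have "clinear (J \<circ> V t)"
      using J(1) linV by (auto intro!: clinearI simp: clinear_add clinear_scaleC)
    ultimately have "surj (J \<circ> V t)"
      by (intro clinear_inj_imp_surj[OF fd(1)])
    then show ?thesis
      using J(2) unfolding surj_def inj_def comp_def by metis
  qed

  show ?thesis
    unfolding rational_inner_function_def
  proof (intro conjI allI impI)
    show "rational_function ?S" using rep by (auto simp: rational_function_def)
    show "\<not> singularity ?S z" if "norm z \<le> 1" for z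
      using rep q[OF that] by (auto simp: singularity_def)
    fix z :: complex
    { assume z: "norm z < 1"
      have adj': "cinner (cadjoint (V z) y) x = cinner y (V z x)" for x y
        by (metis adj cinner_commute)
      show "positive_operator (\<lambda>x. x - cadjoint (rational_value ?S z) (rational_value ?S z x))"
        using positive_operator_diff[OF adj disc[OF z]] val z by simp
      show "positive_operator (\<lambda>y. y - rational_value ?S z (cadjoint (rational_value ?S z) y))"
        using positive_operator_diff[OF adj' adjoint_contraction[OF adj disc[OF z]]] val z by simp }
    { assume t: "norm z = 1"
      have left: "cadjoint (V z) (V z x) = x" for x
        by (rule adjoint_isometry_cancel[OF adj circle[OF t]])
      then have "V z (cadjoint (V z) y) = y" for y
        using surj[OF t] by (metis surjD)
      then show "(\<lambda>x. x - cadjoint (rational_value ?S z) (rational_value ?S z x)) = (\<lambda>x. 0)"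
        "(\<lambda>y. y - rational_value ?S z (cadjoint (rational_value ?S z) y)) = (\<lambda>y. 0)"
        using left t by (simp_all add: val) }
  qed (fact fd)+
qed

end
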